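(* For any positive integer $\ell$ there exists a graph $G$ such that $\omega\big(\mathcal{N}(G)\big)-\Delta(G)>\ell$.
   Context: All graphs are finite and simple. The two-step graph $\mathcal{N}(G)$ of a graph $G$ is the graph with vertex set $V(G)$ in which two distinct vertices are adjacent if and only if they have a common neighbor in $G$. $\omega$ denotes the clique number and $\Delta(G)$ the maximum degree of $G$. *)

theory Defs
  imports Main "Graph_Theory.Pair_Digraph"
begin

text \<open>
  A finite simple graph is a symmetric loop-free digraph on a finite vertex set without
  parallel arcs (locale \<^locale>\<open>pair_graph\<close>); an edge \<open>uv\<close> is the pair of arcs
  \<open>(u, v)\<close> and \<open>(v, u)\<close>.
\<close>

definition two_step_graph :: "'a pair_pre_digraph \<Rightarrow> 'a pair_pre_digraph" where
  "two_step_graph G =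
    \<lparr> pverts = pverts G,
      parcs = {(u, v). u \<in> pverts G \<and> v \<in> pverts G \<and> u \<noteq> v \<and>
        (\<exists>w \<in> pverts G. (u, w) \<in> parcs G \<and> (v, w) \<in> parcs G)} \<rparr>"

definition is_clique :: "'a pair_pre_digraph \<Rightarrow> 'a set \<Rightarrow> bool" where
  "is_clique G S \<longleftrightarrow>
    S \<subseteq> pverts G \<and> (\<forall>u \<in> S. \<forall>v \<in> S. u \<noteq> v \<longrightarrow> (u, v) \<in> parcs G)"

definition clique_number :: "'a pair_pre_digraph \<Rightarrow> nat" where
  "clique_number G = Max {card S | S. is_clique G S}"

text \<open>
  Each edge at \<open>v\<close> contributes exactly one arc leaving \<open>v\<close>, so the degree of \<open>v\<close> is its
  out-degree. Inserting 0 only matters for the null graph, whose maximum degree is 0.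
\<close>

definition max_degree :: "'a pair_pre_digraph \<Rightarrow> nat" where
  "max_degree G = Max (insert 0 (out_degree (with_proj G) ` pverts G))"

lemma out_degree_eq_card_neighbors:
  "out_degree (with_proj G) v = card {u. (v, u) \<in> parcs G}"
proof -
  have "out_arcs (with_proj G) v = Pair v ` {u. (v, u) \<in> parcs G}"
    by (auto simp: out_arcs_def)
  then show ?thesis
    by (simp add: out_degree_def card_image inj_on_def)
qed

lemma pair_graph_two_step_graph:
  assumes "pair_graph G"
  shows "pair_graph (two_step_graph G)"
proof -
  interpret pair_graph G by fact
  have "finite (parcs (two_step_graph G))"
    by (rule finite_subset[of _ "pverts G \<times> pverts G"]) (auto simp: two_step_graph_def)
  then show ?thesis
    by unfold_locales (auto simp: two_step_graph_def symmetric_def intro!: symI)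
qed

end

(* Split 3s points into three groups of size s and add, for each group, a hub adjacent to exactly
   the points outside that group. Two points meet at most two groups, hence share the hub of a
   remaining one, so the points form a clique of size 3s in the two-step graph; but hubs have
   degree 2s and points have degree 2. *)
theory Submission
  imports Defs
begin

lemma card_le_clique_number:
  assumes "finite (pverts G)" "is_clique G S"
  shows "card S \<le> clique_number G"
proof -
  \<comment> \<open>\<open>Max\<close> bounds its elements only on a finite set, so the clique sizes
    are first enclosed in a finite one.\<close>
  have "{card S | S. is_clique G S} \<subseteq> card ` Pow (pverts G)"
    by (auto simp: is_clique_def)
  then have "finite {card S | S. is_clique G S}"
    using assms(1) by (meson finite_Pow_iff finite_imageI finite_subset)
  then show ?thesis
    unfolding clique_number_def using assms(2) by (intro Max_ge) auto
qed

lemma max_degree_le: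
  assumes "finite (pverts G)" "\<And>v. v \<in> pverts G \<Longrightarrow> card {u. (v, u) \<in> parcs G} \<le> k"
  shows "max_degree G \<le> k"
  unfolding max_degree_def using assms by (auto simp: out_degree_eq_card_neighbors)

text \<open>
  The points are the numbers below \<open>3 * s\<close>, grouped by residue modulo 3; the hub of the group of
  residue \<open>j\<close> is \<open>3 * s + j\<close>, which has residue \<open>j\<close> itself.
\<close>

definition hub_graph :: "nat \<Rightarrow> nat pair_pre_digraph" where
  "hub_graph s =
    \<lparr> pverts = {..<3 * s + 3},
      parcs = {(u, v). u < 3 * s + 3 \<and> v < 3 * s + 3 \<and>
        (u < 3 * s \<longleftrightarrow> \<not> v < 3 * s) \<and> u mod 3 \<noteq> v mod 3} \<rparr>"

lemma pair_graph_hub_graph: "pair_graph (hub_graph s)"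
proof -
  have "finite (parcs (hub_graph s))"
    by (rule finite_subset[of _ "{..<3 * s + 3} \<times> {..<3 * s + 3}"]) (auto simp: hub_graph_def)
  then show ?thesis
    by unfold_locales (auto simp: hub_graph_def symmetric_def intro!: symI)
qed

lemma is_clique_hub_graph: "is_clique (two_step_graph (hub_graph s)) {..<3 * s}"
proof -
  have "\<exists>w < 3 * s + 3. \<not> w < 3 * s \<and> u mod 3 \<noteq> w mod 3 \<and> v mod 3 \<noteq> w mod 3" for u v :: nat
  proof -
    have "\<exists>j < 3. u mod 3 \<noteq> j \<and> v mod 3 \<noteq> j"
      by presburger
    then obtain j where "j < 3" "u mod 3 \<noteq> j" "v mod 3 \<noteq> j"
      by blast
    then show ?thesis
      by (intro exI[of _ "3 * s + j"]) simp
  qed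
  then show ?thesis
    by (fastforce simp: is_clique_def two_step_graph_def hub_graph_def)
qed

text \<open>Division by 3 matches each residue class below \<open>3 * s\<close> with
  \<open>{..<s}\<close>; discarding one class leaves two. This counts the neighbors of a
  hub.\<close>

lemma card_mod_neq:
  assumes "j < 3"
  shows "card {u. u < 3 * s \<and> j \<noteq> u mod 3} = 2 * s"
proof -
  have "{u. u < 3 * s \<and> u mod 3 = j} = (\<lambda>i. 3 * i + j) ` {..<s}"
  proof (intro set_eqI iffI)
    fix u assume "u \<in> {u. u < 3 * s \<and> u mod 3 = j}"
    then have "u div 3 < s" "u = 3 * (u div 3) + j"
      by auto
    then show "u \<in> (\<lambda>i. 3 * i + j) ` {..<s}"
      by blast
  qed (use assms in auto)
  then have "card {u. u < 3 * s \<and> u mod 3 = j} = s"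
    by (simp add: card_image inj_on_def)
  moreover have "{u. u < 3 * s \<and> j \<noteq> u mod 3} = {..<3 * s} - {u. u < 3 * s \<and> u mod 3 = j}"
    by auto
  ultimately show ?thesis
    by (simp add: card_Diff_subset subset_iff)
qed

lemma max_degree_hub_graph:
  assumes "s > 0"
  shows "max_degree (hub_graph s) \<le> 2 * s"
proof (rule max_degree_le)
  fix v
  show "card {u. (v, u) \<in> parcs (hub_graph s)} \<le> 2 * s"
  proof (cases "v < 3 * s")
    case True
    \<comment> \<open>A point can only be adjacent to the two hubs of other residues, and
      \<open>2 \<le> 2 * s\<close> because \<open>s\<close> is positive.\<close>
    from True have "{u. (v, u) \<in> parcs (hub_graph s)} \<subseteq> {3 * s..<3 * s + 3} - {3 * s + v mod 3}"
      by (auto simp: hub_graph_def)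
    then have "card {u. (v, u) \<in> parcs (hub_graph s)} \<le> card ({3 * s..<3 * s + 3} - {3 * s + v mod 3})"
      by (intro card_mono) auto
    also have "\<dots> = 2"
      by (simp add: card_Diff_singleton)
    finally show ?thesis
      using assms by simp
  next
    case False
    \<comment> \<open>Here \<open>v\<close> is a hub or lies outside the graph; in the latter case
      it has no neighbors, so an inclusion is claimed rather than an equality.\<close>
    then have "{u. (v, u) \<in> parcs (hub_graph s)} \<subseteq> {u. u < 3 * s \<and> v mod 3 \<noteq> u mod 3}"
      by (auto simp: hub_graph_def)
    then have "card {u. (v, u) \<in> parcs (hub_graph s)} \<le> card {u. u < 3 * s \<and> v mod 3 \<noteq> u mod 3}"
      by (intro card_mono) auto
    then show ?thesis
      by (simp add: card_mod_neq)
  qed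
qed (simp add: hub_graph_def)

theorem corollary8:
  fixes l :: nat
  assumes "l > 0"
  shows "\<exists>G :: nat pair_pre_digraph. pair_graph G \<and>
    int (clique_number (two_step_graph G)) - int (max_degree G) > int l"
proof (intro exI conjI)
  \<comment> \<open>For group size \<open>s\<close> the difference is at least
    \<open>3 * s - 2 * s = s\<close>, so \<open>s = l + 1\<close> exceeds \<open>l\<close>.\<close>
  show "pair_graph (hub_graph (l + 1))"
    by (rule pair_graph_hub_graph)
  have "finite (pverts (two_step_graph (hub_graph (l + 1))))"
    by (simp add: two_step_graph_def hub_graph_def)
  from card_le_clique_number[OF this is_clique_hub_graph]
  have "3 * (l + 1) \<le> clique_number (two_step_graph (hub_graph (l + 1)))"
    by simp
  then show "int (clique_number (two_step_graph (hub_graph (l + 1))))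
      - int (max_degree (hub_graph (l + 1))) > int l"
    using max_degree_hub_graph[of "l + 1"] by simp
qed

end
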